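(* Let $G$ be a proper probability distribution function on $[0,\infty)$, let $p\in(0,1)$ be arbitrary and put $q=1-p$. Let $Z$ be the probability distribution function on $[0,\infty)$ that solves the renewal equation $$Z(x)=p\,G(x)+q\,(Z*G)(x),\qquad x\ge 0 .$$ Then $Z$ is geometrically infinitely divisible if and only if $G$ is geometrically infinitely divisible.
   Context: For distribution functions $Z,G$ on $[0,\infty)$, $(Z*G)(x)=\int_{[0,x]}Z(x-y)\,dG(y)$. A "proper" distribution function is one of total mass $1$. A random variable $Y$ (or its distribution) is geometrically infinitely divisible (GID) if for every $r\in(0,1)$ there are i.i.d. random variables $Y^{(r)}_1,Y^{(r)}_2,\dots$ and a random variable $N_r$ independent of them with $P(N_r=k)=r(1-r)^{k-1}$, $k=1,2,\dots$, such that $Y\overset{d}{=}\sum_{j=1}^{N_r}Y^{(r)}_j$. For distributions on $[0,\infty)$ this is equivalent to the Laplace transform having the form $1/[1+\psi(s)]$ with $\psi(0)=0$ and $\psi$ having a completely monotone derivative on $s>0$. *)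

theory Defs
  imports "HOL-Probability.Probability"
begin

definition proper_df_nonneg :: "(real \<Rightarrow> real) \<Rightarrow> bool" where
  "proper_df_nonneg F \<longleftrightarrow>
     mono F \<and> (\<forall>x. continuous (at_right x) F) \<and>
     (\<forall>x<0. F x = 0) \<and> (F \<longlongrightarrow> 1) at_top"

(* interval_measure G is the Lebesgue-Stieltjes measure of G, so a jump of G at 0 is an atom
   at 0 and is included in the integral. *)
definition df_convolution :: "(real \<Rightarrow> real) \<Rightarrow> (real \<Rightarrow> real) \<Rightarrow> real \<Rightarrow> real" where
  "df_convolution Z G x = (LINT y:{0..x}|interval_measure G. Z (x - y))"

(* On the probability space M, the law D is that of Y 1 + ... + Y N, where Y 1, Y 2, ... are
   i.i.d. and N is independent of the whole sequence and geometric on {1, 2, ...}. The constant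
   indep_var needs two variables of the same type, so independence of N and the sequence is
   stated by indep_set for the sigma-algebras they generate. *)
definition geometric_sum_representation ::
    "real measure \<Rightarrow> real \<Rightarrow> 'a measure \<Rightarrow> ('a \<Rightarrow> nat) \<Rightarrow> (nat \<Rightarrow> 'a \<Rightarrow> real) \<Rightarrow> bool" where
  "geometric_sum_representation D r M N Y \<longleftrightarrow>
     prob_space M \<and>
     prob_space.indep_vars M (\<lambda>_. borel) Y {1..} \<and>
     (\<forall>j\<ge>1. distr M borel (Y j) = distr M borel (Y 1)) \<and>
     N \<in> measurable M (count_space UNIV) \<and>
     prob_space.indep_set M
       {N -` A \<inter> space M | A. A \<in> sets (count_space UNIV)}
       {(\<lambda>\<omega>. \<lambda>j\<in>{1..}. Y j \<omega>) -` B \<inter> space M | B. B \<in> sets (PiM {1..} (\<lambda>_. borel))} \<and>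
     (\<forall>k\<ge>1. measure M {\<omega> \<in> space M. N \<omega> = k} = r * (1 - r) ^ (k - 1)) \<and>
     distr M borel (\<lambda>\<omega>. \<Sum>j=1..N \<omega>. Y j \<omega>) = D"

(* A definition cannot quantify over the type of the sample space. Nothing is lost by taking
   nat \<times> (nat \<Rightarrow> real), the space of values of (N, Y); see geometrically_inf_divisibleI. *)
definition geometrically_inf_divisible :: "real measure \<Rightarrow> bool" where
  "geometrically_inf_divisible D \<longleftrightarrow>
     (\<forall>r\<in>{0<..<1}. \<exists>(M :: (nat \<times> (nat \<Rightarrow> real)) measure) N Y.
        geometric_sum_representation D r M N Y)"

lemma geometric_sum_representation_canonical:
  assumes "geometric_sum_representation D r (M :: 'a measure) N Y"
  shows "\<exists>(M' :: (nat \<times> (nat \<Rightarrow> real)) measure) N' Y'.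
           geometric_sum_representation D r M' N' Y'"
proof -
  note One_nat_def [simp del]
  let ?I = "{1..} :: nat set"
  let ?P = "PiM ?I (\<lambda>_. borel :: real measure)"
  let ?C = "count_space UNIV :: nat measure"
  let ?Y = "\<lambda>\<omega>. \<lambda>j\<in>?I. Y j \<omega>"
  let ?g = "\<lambda>\<omega>. (N \<omega>, ?Y \<omega>)"
  define M' where "M' = distr M (?C \<Otimes>\<^sub>M ?P) ?g"
  define N' where "N' = (fst :: nat \<times> (nat \<Rightarrow> real) \<Rightarrow> nat)"
  define Y' where "Y' = (\<lambda>(j::nat) (p :: nat \<times> (nat \<Rightarrow> real)). snd p j)"
  interpret M: prob_space M
    using assms by (simp add: geometric_sum_representation_def)
  have iv: "M.indep_vars (\<lambda>_. borel) Y ?I"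
    and same: "\<And>j. j \<ge> 1 \<Longrightarrow> distr M borel (Y j) = distr M borel (Y 1)"
    and mN [measurable]: "N \<in> measurable M ?C"
    and ind: "M.indep_set {N -` A \<inter> space M | A. A \<in> sets ?C}
                {?Y -` B \<inter> space M | B. B \<in> sets ?P}"
    and geo: "\<And>k. k \<ge> 1 \<Longrightarrow> measure M {\<omega> \<in> space M. N \<omega> = k} = r * (1 - r) ^ (k - 1)"
    and law: "distr M borel (\<lambda>\<omega>. \<Sum>j=1..N \<omega>. Y j \<omega>) = D"
    using assms unfolding geometric_sum_representation_def by blast+
  have mY [measurable]: "Y j \<in> borel_measurable M" if "j \<ge> 1" for j
    using iv that unfolding M.indep_vars_def by auto
  have mYs [measurable]: "?Y \<in> measurable M ?P"
    by (rule measurable_restrict) (use mY in auto)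
  have mg [measurable]: "?g \<in> measurable M (?C \<Otimes>\<^sub>M ?P)"
    by (rule measurable_Pair[OF mN mYs])
  interpret M': prob_space M'
    unfolding M'_def by (rule M.prob_space_distr[OF mg])
  have sets': "sets M' = sets (?C \<Otimes>\<^sub>M ?P)" by (simp add: M'_def)
  have mN': "N' \<in> measurable M' ?C"
    unfolding N'_def M'_def by simp
  have mY': "Y' j \<in> borel_measurable M'" if "j \<ge> 1" for j
    using that unfolding Y'_def M'_def by simp
  have mYs': "(\<lambda>\<omega>. \<lambda>j\<in>?I. Y' j \<omega>) \<in> measurable M' ?P"
    by (rule measurable_restrict) (use mY' in auto)
  have dY: "distr M' borel (Y' j) = distr M borel (Y j)" if "j \<ge> 1" for j
  proof -
    have "distr M' borel (Y' j) = distr M borel (Y' j \<circ> ?g)"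
      unfolding M'_def using mY'[OF that] by (intro distr_distr mg) (simp add: M'_def)
    also have "Y' j \<circ> ?g = Y j"
      using that by (auto simp: Y'_def)
    finally show ?thesis .
  qed
  have restr: "(\<lambda>\<omega>. \<lambda>j\<in>?I. Y' j \<omega>) \<circ> ?g = ?Y"
    by (auto simp: Y'_def fun_eq_iff)
  have dYs: "distr M' ?P (\<lambda>\<omega>. \<lambda>j\<in>?I. Y' j \<omega>) = distr M ?P ?Y"
  proof -
    have "distr M' ?P (\<lambda>\<omega>. \<lambda>j\<in>?I. Y' j \<omega>) = distr M ?P ((\<lambda>\<omega>. \<lambda>j\<in>?I. Y' j \<omega>) \<circ> ?g)"
      unfolding M'_def using mYs' by (intro distr_distr mg) (simp add: M'_def)
    then show ?thesis by (simp only: restr)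
  qed
  have dN: "distr M' ?C N' = distr M ?C N"
  proof -
    have "distr M' ?C N' = distr M ?C (N' \<circ> ?g)"
      unfolding M'_def using mN' by (intro distr_distr mg) (simp add: M'_def)
    also have "N' \<circ> ?g = N" by (auto simp: N'_def)
    finally show ?thesis .
  qed
  have "M'.indep_vars (\<lambda>_. borel) Y' ?I"
  proof -
    have "distr M ?P ?Y = PiM ?I (\<lambda>i. distr M borel (Y i))"
      using iv mY by (subst (asm) M.indep_vars_iff_distr_eq_PiM') auto
    then have "distr M' ?P (\<lambda>\<omega>. \<lambda>j\<in>?I. Y' j \<omega>) = PiM ?I (\<lambda>i. distr M' borel (Y' i))"
      unfolding dYs by (simp only:) (intro PiM_cong, auto simp: dY)
    then show ?thesis
      using mY' by (subst M'.indep_vars_iff_distr_eq_PiM') auto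
  qed
  moreover have "distr M' borel (Y' j) = distr M' borel (Y' 1)" if "j \<ge> 1" for j
    using same[OF that] that by (simp add: dY)
  moreover have "M'.indep_set {N' -` A \<inter> space M' | A. A \<in> sets ?C}
                   {(\<lambda>\<omega>. \<lambda>j\<in>?I. Y' j \<omega>) -` B \<inter> space M' | B. B \<in> sets ?P}"
  proof -
    let ?Y' = "\<lambda>\<omega>. \<lambda>j\<in>?I. Y' j \<omega>"
    have pull: "measure M' (E \<inter> space M') = measure M (?g -` E \<inter> space M)"
      if "E \<inter> space M' \<in> sets M'" for E
    proof -
      have "measure M' (E \<inter> space M') = measure M (?g -` (E \<inter> space M') \<inter> space M)"
        using that unfolding M'_def by (subst measure_distr[OF mg]) (auto simp: M'_def)
      also have "?g -` (E \<inter> space M') \<inter> space M = ?g -` E \<inter> space M"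
        using measurable_space[OF mg] by (auto simp: M'_def)
      finally show ?thesis .
    qed
    have "measure M' ((N' -` A \<inter> space M') \<inter> (?Y' -` B \<inter> space M')) =
          measure M' (N' -` A \<inter> space M') * measure M' (?Y' -` B \<inter> space M')"
      if B: "B \<in> sets ?P" for A B
    proof -
      have eN: "N' -` A \<inter> space M' \<in> sets M'" by (rule measurable_sets[OF mN']) simp
      have eY: "?Y' -` B \<inter> space M' \<in> sets M'" by (rule measurable_sets[OF mYs' B])
      have eNY: "(N' -` A \<inter> ?Y' -` B) \<inter> space M' \<in> sets M'"
        using sets.Int[OF eN eY] by (simp add: Int_ac)
      have gY: "?g -` (?Y' -` B) = ?Y -` B"
        unfolding vimage_comp restr ..
      have gN: "?g -` (N' -` A) = N -` A"
        by (auto simp: N'_def)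
      have "measure M' ((N' -` A \<inter> space M') \<inter> (?Y' -` B \<inter> space M')) =
            measure M' ((N' -` A \<inter> ?Y' -` B) \<inter> space M')"
        by (rule arg_cong[where f = "measure M'"]) blast
      also have "\<dots> = measure M (?g -` (N' -` A \<inter> ?Y' -` B) \<inter> space M)"
        by (rule pull[OF eNY])
      also have "?g -` (N' -` A \<inter> ?Y' -` B) \<inter> space M = (N -` A \<inter> space M) \<inter> (?Y -` B \<inter> space M)"
        unfolding vimage_Int gN gY by blast
      also have "measure M \<dots> = measure M (N -` A \<inter> space M) * measure M (?Y -` B \<inter> space M)"
        by (rule M.indep_setD[OF ind]) (use B in auto)
      also have "\<dots> = measure M' (N' -` A \<inter> space M') * measure M' (?Y' -` B \<inter> space M')"
        unfolding pull[OF eN] pull[OF eY] gN gY ..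
      finally show ?thesis .
    qed
    note indep = this
    show ?thesis
      unfolding M'.indep_sets2_eq
    proof (intro conjI ballI)
      show "{N' -` A \<inter> space M' | A. A \<in> sets ?C} \<subseteq> sets M'"
        using measurable_sets[OF mN'] by auto
      show "{?Y' -` B \<inter> space M' | B. B \<in> sets ?P} \<subseteq> sets M'"
        using measurable_sets[OF mYs'] by auto
    next
      fix a b
      assume "a \<in> {N' -` A \<inter> space M' | A. A \<in> sets ?C}"
        and "b \<in> {?Y' -` B \<inter> space M' | B. B \<in> sets ?P}"
      then obtain A B where "a = N' -` A \<inter> space M'" "b = ?Y' -` B \<inter> space M'" "B \<in> sets ?P"
        by (elim CollectE exE conjE)
      then show "measure M' (a \<inter> b) = measure M' a * measure M' b"
        by (simp only: indep)
    qed
  qed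
  moreover have "measure M' {\<omega> \<in> space M'. N' \<omega> = k} = r * (1 - r) ^ (k - 1)"
    if "k \<ge> 1" for k
  proof -
    have "measure M' {\<omega> \<in> space M'. N' \<omega> = k} = measure (distr M' ?C N') {k}"
      using mN' by (subst measure_distr) (auto intro!: arg_cong[where f = "measure M'"])
    also have "\<dots> = measure M {\<omega> \<in> space M. N \<omega> = k}"
      unfolding dN by (subst measure_distr) (auto intro!: arg_cong[where f = "measure M"])
    finally show ?thesis using geo[OF that] by simp
  qed
  moreover have "distr M' borel (\<lambda>\<omega>. \<Sum>j=1..N' \<omega>. Y' j \<omega>) = D"
  proof -
    let ?S = "\<lambda>\<omega>. \<Sum>j=1..N' \<omega>. Y' j \<omega>"
    have "?S \<in> borel_measurable M'"
    proof (rule measurable_compose_countable[where f = "\<lambda>n \<omega>. \<Sum>j=1..n. Y' j \<omega>" and g = N'])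
      show "(\<lambda>\<omega>. \<Sum>j=1..n. Y' j \<omega>) \<in> borel_measurable M'" for n
        using mY' by (intro borel_measurable_sum) auto
    qed (rule mN')
    then have "distr M' borel ?S = distr M borel (?S \<circ> ?g)"
      unfolding M'_def by (intro distr_distr mg) (simp add: M'_def)
    also have "?S \<circ> ?g = (\<lambda>\<omega>. \<Sum>j=1..N \<omega>. Y j \<omega>)"
      by (auto simp: N'_def Y'_def fun_eq_iff intro!: sum.cong)
    finally show ?thesis using law by simp
  qed
  ultimately have "geometric_sum_representation D r M' N' Y'"
    unfolding geometric_sum_representation_def using M'.prob_space_axioms mN' by blast
  then show ?thesis by blast
qed

lemma geometrically_inf_divisibleI:
  assumes "\<And>r. 0 < r \<Longrightarrow> r < 1 \<Longrightarrow>
    \<exists>(M :: 'a measure) N Y. geometric_sum_representation D r M N Y"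
  shows "geometrically_inf_divisible D"
  unfolding geometrically_inf_divisible_def
proof
  fix r :: real
  assume "r \<in> {0<..<1}"
  then obtain M :: "'a measure" and N Y where "geometric_sum_representation D r M N Y"
    using assms[of r] by auto
  then show "\<exists>(M :: (nat \<times> (nat \<Rightarrow> real)) measure) N Y. geometric_sum_representation D r M N Y"
    by (rule geometric_sum_representation_canonical)
qed

end

(* Write C r w = r w / (1 - (1 - r) w). The characteristic function of a geometric(r) sum of
   i.i.d. variables with characteristic function w is C r w, and C r (C s w) = C (r s) w with
   each C r injective on the unit disc. The renewal equation says that char Z = C p (char G).
   If Z = C (p r) mu, then cancelling C p gives G = C r mu. If G is geometrically infinitely
   divisible, then Z = C r (mu) with G = C (r/p) mu for r < p, with mu = G for r = p, and with
   mu = C (p/r) G for r > p. *)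
theory Submission
  imports Defs
begin

section \<open>Algebra of the geometric compounding map\<close>

text \<open>The probability generating function of the geometric law on {1, 2, ...} with success
  probability \<open>r\<close>, taken at a complex argument.\<close>

definition geometric_compound :: "real \<Rightarrow> complex \<Rightarrow> complex" where
  "geometric_compound r w = r * w / (1 - (1 - r) * w)"

lemma geometric_compound_denominator_nonzero:
  fixes w :: complex and r :: real
  assumes "0 < r" "r < 1" "norm w \<le> 1"
  shows "1 - (1 - r) * w \<noteq> 0"
proof
  assume "1 - (1 - r) * w = 0"
  then have "norm ((1 - r) * w) = 1"
    by (metis eq_iff_diff_eq_0 norm_one)
  moreover have "norm ((1 - r) * w) \<le> 1 - r"
    using assms mult_left_le[of "norm w" "1 - r"] by (simp add: norm_mult mult.commute del: of_real_diff)
  ultimately show False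
    using assms by simp
qed

text \<open>A geometric(\<open>r\<close>) number of independent geometric(\<open>s\<close>) counts
  adds up to a geometric(\<open>r * s\<close>) count; composing the generating functions expresses
  this. Algebraically, the inner denominator cancels from the outer fraction.\<close>

lemma geometric_compound_compose:
  fixes w :: complex and r s :: real
  assumes "0 < r" "r < 1" "0 < s" "s < 1" "norm w \<le> 1"
  shows "geometric_compound r (geometric_compound s w) = geometric_compound (r * s) w"
proof -
  have nz: "1 - (1 - s) * w \<noteq> 0" "1 - (1 - r * s) * w \<noteq> 0"
    using geometric_compound_denominator_nonzero[of s w]
      geometric_compound_denominator_nonzero[of "r * s" w] assms
      mult_strict_mono[of r 1 s 1] by auto
  have "1 - (1 - r) * (s * w / (1 - (1 - s) * w)) = (1 - (1 - r * s) * w) / (1 - (1 - s) * w)"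
    using nz(1) by (simp add: divide_simps) (simp add: algebra_simps)
  then show ?thesis
    using nz unfolding geometric_compound_def by simp
qed

text \<open>The map is fractional linear: once the denominators are cleared, the terms in
  \<open>v * w\<close> agree on both sides and cancel.\<close>

lemma geometric_compound_inject:
  fixes v w :: complex and r :: real
  assumes "0 < r" "r < 1" "norm v \<le> 1" "norm w \<le> 1"
    and "geometric_compound r v = geometric_compound r w"
  shows "v = w"
proof -
  have "r * v * (1 - (1 - r) * w) = r * w * (1 - (1 - r) * v)"
    using assms geometric_compound_denominator_nonzero[of r v]
      geometric_compound_denominator_nonzero[of r w]
    unfolding geometric_compound_def by (simp add: frac_eq_eq)
  then have "r * v = r * w"
    by (simp add: algebra_simps)
  then show ?thesis
    using assms by simp
qed

text \<open>A geometric series with ratio \<open>(1 - r) * w\<close>, of norm below 1. The exponent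
  \<open>Suc k\<close> reflects that the count starts at 1.\<close>

lemma geometric_compound_sums:
  fixes w :: complex and r :: real
  assumes "0 < r" "r < 1" "norm w \<le> 1"
  shows "(\<lambda>k. (r * (1 - r) ^ k) *\<^sub>R w ^ Suc k) sums geometric_compound r w"
proof -
  have "norm ((1 - r) * w) \<le> 1 - r"
    using assms mult_left_le[of "norm w" "1 - r"] by (simp add: norm_mult mult.commute del: of_real_diff)
  then have "norm ((1 - r) * w) < 1"
    using assms by linarith
  from sums_mult[OF geometric_sums[OF this], of "r * w"] show ?thesis
    by (simp add: geometric_compound_def scaleR_conv_of_real power_mult_distrib mult_ac)
qed

section \<open>Characteristic functions of geometric sums\<close>

text \<open>The product rule for expectations is applied to an \<open>indep_var\<close> pair, whose
  members share a type, whereas the count and the sequence of summands have different types.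
  Composing with \<open>f\<close> and \<open>g\<close> brings both into one type.\<close>

lemma (in prob_space) indep_var_compose_indep_set:
  assumes X: "X \<in> measurable M S" and Y: "Y \<in> measurable M T"
    and ind: "indep_set {X -` A \<inter> space M | A. A \<in> sets S} {Y -` B \<inter> space M | B. B \<in> sets T}"
    and f: "f \<in> measurable S U" and g: "g \<in> measurable T V"
  shows "indep_var U (f \<circ> X) V (g \<circ> Y)"
proof -
  have pre: "(f \<circ> X) -` A \<inter> space M = X -` (f -` A \<inter> space S) \<inter> space M"
    if "X \<in> measurable M S" for f and X :: "'a \<Rightarrow> 'x" and S A
    using measurable_space[OF that] by auto
  \<comment> \<open>\<open>indep_var\<close> asks for independence of the generated sigma-algebras.
    For families of preimages closed under intersection this follows from independence of the
    families themselves.\<close>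
  have Int_stable: "Int_stable {W -` A \<inter> space M | A. A \<in> sets R}" for W :: "'a \<Rightarrow> 'x" and R
  proof (rule Int_stableI, clarify)
    fix A B assume "A \<in> sets R" "B \<in> sets R"
    then show "\<exists>C. W -` A \<inter> space M \<inter> (W -` B \<inter> space M) = W -` C \<inter> space M \<and> C \<in> sets R"
      by (intro exI[of _ "A \<inter> B"]) auto
  qed
  have "indep_set {(f \<circ> X) -` A \<inter> space M | A. A \<in> sets U}
     {(g \<circ> Y) -` B \<inter> space M | B. B \<in> sets V}"
  proof (rule indep_setI)
    show "{(f \<circ> X) -` A \<inter> space M | A. A \<in> sets U} \<subseteq> events"
      "{(g \<circ> Y) -` B \<inter> space M | B. B \<in> sets V} \<subseteq> events"
      using measurable_sets[OF measurable_comp[OF X f]] measurable_sets[OF measurable_comp[OF Y g]]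
      by blast+
    fix a b
    assume "a \<in> {(f \<circ> X) -` A \<inter> space M | A. A \<in> sets U}"
      and "b \<in> {(g \<circ> Y) -` B \<inter> space M | B. B \<in> sets V}"
    then obtain A B where a: "a = (f \<circ> X) -` A \<inter> space M" and A: "A \<in> sets U"
      and b: "b = (g \<circ> Y) -` B \<inter> space M" and B: "B \<in> sets V"
      by (elim CollectE exE conjE)
    show "prob (a \<inter> b) = prob a * prob b"
      unfolding a b pre[OF X] pre[OF Y]
      using measurable_sets[OF f A] measurable_sets[OF g B] by (intro indep_setD[OF ind]) blast+
  qed
  then show ?thesis
    unfolding indep_var_eq
    using measurable_comp[OF X f] measurable_comp[OF Y g]
    by (auto intro!: indep_set_sigma_sets Int_stable)
qed

text \<open>Splitting over the value of \<open>N\<close> reduces the random sum to fixed sums: by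
  independence the event \<open>N = k\<close> contributes its probability times the
  \<open>k\<close>-th power of the characteristic function of a summand. Summing over
  \<open>k\<close> gives the power series of \<open>geometric_compound\<close>.\<close>

lemma
  assumes "geometric_sum_representation D r M N Y" "0 < r" "r < 1"
  shows real_distribution_geometric_sum: "real_distribution D"
    and real_distribution_geometric_summand: "real_distribution (distr M borel (Y 1))"
    and char_geometric_sum:
      "char D t = geometric_compound r (char (distr M borel (Y 1)) t)"
proof -
  note One_nat_def [simp del]
  let ?I = "{1..} :: nat set"
  let ?P = "PiM ?I (\<lambda>_. borel :: real measure)"
  let ?C = "count_space UNIV :: nat measure"
  let ?Y = "\<lambda>\<omega>. \<lambda>j\<in>?I. Y j \<omega>"
  interpret prob_space M
    using assms by (simp add: geometric_sum_representation_def)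
  have iv: "indep_vars (\<lambda>_. borel) Y ?I"
    and same: "\<And>j. j \<ge> 1 \<Longrightarrow> distr M borel (Y j) = distr M borel (Y 1)"
    and mN [measurable]: "N \<in> measurable M ?C"
    and ind: "indep_set {N -` A \<inter> space M | A. A \<in> sets ?C}
                {?Y -` B \<inter> space M | B. B \<in> sets ?P}"
    and geo: "\<And>k. k \<ge> 1 \<Longrightarrow> measure M {\<omega> \<in> space M. N \<omega> = k} = r * (1 - r) ^ (k - 1)"
    and law: "D = distr M borel (\<lambda>\<omega>. \<Sum>j=1..N \<omega>. Y j \<omega>)"
    using assms unfolding geometric_sum_representation_def by blast+
  have mY [measurable]: "Y j \<in> borel_measurable M" if "j \<ge> 1" for j
    using iv that unfolding indep_vars_def by auto
  have mYs [measurable]: "?Y \<in> measurable M ?P"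
    by (rule measurable_restrict) (use mY in auto)
  let ?S = "\<lambda>k \<omega>. \<Sum>j=1..k. Y j \<omega>"
  have mS [measurable]: "?S k \<in> borel_measurable M" for k
    using mY by (intro borel_measurable_sum) auto
  have mSN [measurable]: "(\<lambda>\<omega>. ?S (N \<omega>) \<omega>) \<in> borel_measurable M"
    by (rule measurable_compose_countable[where f = ?S and g = N]) auto
  show "real_distribution D"
    unfolding law by simp
  show rd: "real_distribution (distr M borel (Y 1))"
    by simp
  let ?\<phi> = "char (distr M borel (Y 1))"
  have charS: "(\<integral>\<omega>. iexp (t * ?S k \<omega>) \<partial>M) = ?\<phi> t ^ k" for t k
  proof -
    have "(\<integral>\<omega>. iexp (t * ?S k \<omega>) \<partial>M) = char (distr M borel (?S k)) t"
      by (simp add: char_def integral_distr)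
    also have "\<dots> = (\<Prod>j=1..k. char (distr M borel (Y j)) t)"
      by (rule char_distr_sum) (rule indep_vars_subset[OF iv], auto)
    also have "\<dots> = (\<Prod>j=1..k. ?\<phi> t)"
      by (intro prod.cong refl arg_cong[where f = "\<lambda>\<mu>. char \<mu> t"] same) simp
    also have "\<dots> = ?\<phi> t ^ k"
      by simp
    finally show ?thesis .
  qed
  let ?p = "\<lambda>k. measure M {\<omega> \<in> space M. N \<omega> = k}"
  \<comment> \<open>The exponential cut off to the event \<open>N = k\<close>. For each outcome only
    one \<open>k\<close> survives, so the series over \<open>k\<close> recovers the exponential of
    the random sum.\<close>
  let ?h = "\<lambda>t k \<omega>. indicator {k} (N \<omega>) * iexp (t * ?S k \<omega>)"
  have indN: "(\<integral>\<omega>. indicator {k} (N \<omega>) \<partial>M) = complex_of_real (?p k)" for k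
  proof -
    have "(\<integral>\<omega>. indicator {k} (N \<omega>) \<partial>M) =
      (\<integral>\<omega>. complex_of_real (indicator {\<omega> \<in> space M. N \<omega> = k} \<omega>) \<partial>M)"
      by (intro Bochner_Integration.integral_cong) (auto simp: indicator_def)
    also have "\<dots> = ?p k"
      by (subst integral_complex_of_real) simp
    finally show ?thesis .
  qed
  have h_int: "integrable M (?h t k)" for t k
    by (rule integrable_const_bound[where B = 1]) (auto simp: norm_mult indicator_def)
  have h_val: "(\<integral>\<omega>. ?h t k \<omega> \<partial>M) = ?p k *\<^sub>R ?\<phi> t ^ k" for t k
  proof -
    let ?g = "\<lambda>y. iexp (t * (\<Sum>j=1..k. y j))"
    have mg: "?g \<in> borel_measurable ?P"
      by measurable
    have "indep_var borel ((indicator {k} :: nat \<Rightarrow> complex) \<circ> N) borel (?g \<circ> ?Y)"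
      by (rule indep_var_compose_indep_set[OF mN mYs ind _ mg]) simp
    moreover have "?g \<circ> ?Y = (\<lambda>\<omega>. iexp (t * ?S k \<omega>))"
      by (auto simp: fun_eq_iff intro!: arg_cong[where f = iexp] sum.cong)
    moreover have "integrable M ((indicator {k} :: nat \<Rightarrow> complex) \<circ> N)"
      by (rule integrable_const_bound[where B = 1]) (auto simp: indicator_def)
    moreover have "integrable M (\<lambda>\<omega>. iexp (t * ?S k \<omega>))"
      by (rule integrable_const_bound[where B = 1]) auto
    ultimately have "(\<integral>\<omega>. ?h t k \<omega> \<partial>M) =
        (\<integral>\<omega>. indicator {k} (N \<omega>) \<partial>M) * (\<integral>\<omega>. iexp (t * ?S k \<omega>) \<partial>M)"
      using indep_var_lebesgue_integral[of "indicator {k} \<circ> N" "\<lambda>\<omega>. iexp (t * ?S k \<omega>)"]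
      by (simp add: comp_def)
    then show ?thesis
      unfolding indN charS by (simp add: scaleR_conv_of_real)
  qed
  \<comment> \<open>The sum of these norms over \<open>k\<close> is finite, which justifies
    exchanging the series with the integral.\<close>
  have h_norm: "(\<integral>\<omega>. norm (?h t k \<omega>) \<partial>M) = ?p k" for t k
  proof -
    have "(\<integral>\<omega>. norm (?h t k \<omega>) \<partial>M) = (\<integral>\<omega>. indicator {\<omega> \<in> space M. N \<omega> = k} \<omega> \<partial>M)"
      by (intro Bochner_Integration.integral_cong) (auto simp: indicator_def norm_mult)
    then show ?thesis by simp
  qed
  have h_sums: "(\<lambda>k. ?h t k \<omega>) sums iexp (t * ?S (N \<omega>) \<omega>)" for t \<omega>
  proof -
    have "?h t k \<omega> = (if k = N \<omega> then iexp (t * ?S k \<omega>) else 0)" for k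
      by (simp add: indicator_def)
    then show ?thesis
      using sums_single[of "N \<omega>" "\<lambda>k. iexp (t * ?S k \<omega>)"] by (simp only:)
  qed
  have p_Suc: "?p (Suc k) = r * (1 - r) ^ k" for k
    using geo[of "Suc k"] by (simp add: One_nat_def)
  \<comment> \<open>The point masses are prescribed only from 1 on, so summability is checked on the
    shifted sequence.\<close>
  have p_summable: "summable ?p"
    using assms by (subst summable_Suc_iff[symmetric]) (auto simp: p_Suc intro!: summable_mult)
  have sums: "(\<lambda>k. ?p k *\<^sub>R ?\<phi> t ^ k) sums char D t" for t
  proof -
    have "summable (\<lambda>k. norm (?h t k \<omega>))" for \<omega>
      by (rule summable_finite[of "{N \<omega>}"]) auto
    then have "(\<lambda>k. \<integral>\<omega>. ?h t k \<omega> \<partial>M) sums (\<integral>\<omega>. (\<Sum>k. ?h t k \<omega>) \<partial>M)"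
      using p_summable by (intro sums_integral h_int) (simp_all only: h_norm, auto)
    also have "(\<integral>\<omega>. (\<Sum>k. ?h t k \<omega>) \<partial>M) = (\<integral>\<omega>. iexp (t * ?S (N \<omega>) \<omega>) \<partial>M)"
      using h_sums by (simp add: sums_iff)
    also have "\<dots> = char D t"
      unfolding law char_def by (simp add: integral_distr)
    finally show ?thesis
      by (simp only: h_val)
  qed
  have norm_le: "norm (?\<phi> t) \<le> 1" for t
    by (rule real_distribution.cmod_char_le_1[OF rd])
  have char_shift: "char D t = geometric_compound r (?\<phi> t) + ?p 0" for t
  proof -
    have "(\<lambda>k. ?p (Suc k) *\<^sub>R ?\<phi> t ^ Suc k) sums geometric_compound r (?\<phi> t)"
      unfolding p_Suc using assms norm_le by (intro geometric_compound_sums) auto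
    from sums_Suc[OF this] show ?thesis
      using sums[of t] by (simp add: sums_unique2 scaleR_conv_of_real)
  qed
  \<comment> \<open>The hypotheses say nothing about \<open>N = 0\<close>; evaluating at \<open>0\<close> shows that it is a null event.\<close>
  have "?p 0 = 0"
    using char_shift[of 0] assms \<open>real_distribution D\<close> rd
    by (simp add: real_distribution.char_zero geometric_compound_def)
  then show "char D t = geometric_compound r (?\<phi> t)"
    using char_shift by simp
qed

section \<open>Construction of geometric sums with a given summand law\<close>

text \<open>The canonical model is the product of the geometric law with countably many copies of
  \<open>\<mu>\<close>. \<open>N\<close> and the \<open>Y j\<close> are its coordinates, so
  independence comes from the product measures, and \<open>D\<close> is simply the law of the
  resulting sum.\<close>

lemma geometric_sum_representation_exists:
  assumes "real_distribution \<mu>" "0 < r" "r < 1"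
  shows "\<exists>D (M :: (nat \<times> (nat \<Rightarrow> real)) measure) N Y.
    geometric_sum_representation D r M N Y \<and> distr M borel (Y 1) = \<mu>"
proof -
  note One_nat_def [simp del]
  let ?I = "{1..} :: nat set"
  let ?P = "PiM ?I (\<lambda>_. borel :: real measure)"
  let ?C = "count_space UNIV :: nat measure"
  \<comment> \<open>\<open>geometric_pmf\<close> starts at 0; \<open>Suc\<close> moves it to {1, 2,
    ...}.\<close>
  define K where "K = measure_pmf (map_pmf Suc (geometric_pmf r))"
  define L where "L = PiM ?I (\<lambda>_. \<mu>)"
  define M where "M = K \<Otimes>\<^sub>M L"
  define N where "N = (fst :: nat \<times> (nat \<Rightarrow> real) \<Rightarrow> nat)"
  define Y where "Y = (\<lambda>(j::nat) (p :: nat \<times> (nat \<Rightarrow> real)). snd p j)"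
  let ?Y = "\<lambda>\<omega>. \<lambda>j\<in>?I. Y j \<omega>"
  interpret \<mu>: real_distribution \<mu> by fact
  interpret K: prob_space K unfolding K_def by (rule prob_space_measure_pmf)
  interpret L: prob_space L unfolding L_def by (rule prob_space_PiM) unfold_locales
  interpret KL: pair_prob_space K L ..
  interpret prob_space M unfolding M_def by unfold_locales
  have setsK [measurable_cong]: "sets K = sets ?C"
    by (simp add: K_def)
  have setsL [measurable_cong]: "sets L = sets ?P"
    unfolding L_def by (intro sets_PiM_cong) auto
  have setsM [measurable_cong]: "sets M = sets (?C \<Otimes>\<^sub>M ?P)"
    unfolding M_def by (intro sets_pair_measure_cong setsK setsL)
  have spaceM: "space M = UNIV \<times> space ?P"
    using sets_eq_imp_space_eq[OF setsM] by (simp add: space_pair_measure)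
  have mN [measurable]: "N \<in> measurable M ?C"
    unfolding N_def by simp
  have mY [measurable]: "Y j \<in> borel_measurable M" if "j \<ge> 1" for j
    using that unfolding Y_def by simp
  \<comment> \<open>Points of the product space are already \<open>undefined\<close> at the index 0
    outside \<open>?I\<close>, so restricting to \<open>?I\<close> changes nothing.\<close>
  have restr: "?Y \<omega> = snd \<omega>" if "\<omega> \<in> space M" for \<omega>
    using that by (auto simp: spaceM Y_def space_PiM fun_eq_iff PiE_def extensional_def)
  have mYs [measurable]: "?Y \<in> measurable M ?P"
    by (rule measurable_restrict) (use mY in auto)
  have distr_snd: "distr M L snd = L"
  proof (rule measure_eqI)
    fix A assume "A \<in> sets (distr M L snd)"
    then have A: "A \<in> sets L" by simp
    have "emeasure (distr M L snd) A = emeasure M (space K \<times> A)"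
      using sets.sets_into_space[OF A] A
      by (auto simp: M_def emeasure_distr space_pair_measure intro!: arg_cong2[where f = emeasure])
    then show "emeasure (distr M L snd) A = emeasure L A"
      using A by (simp add: M_def L.emeasure_pair_measure_Times K.emeasure_space_1)
  qed simp
  have dYs: "distr M ?P ?Y = L"
  proof -
    have "distr M ?P ?Y = distr M L snd"
      by (rule distr_cong) (auto simp: setsL restr)
    then show ?thesis by (simp only: distr_snd)
  qed
  have dY: "distr M borel (Y j) = \<mu>" if "j \<ge> 1" for j
  proof -
    have "distr M borel (Y j) = distr (distr M L snd) \<mu> (\<lambda>\<omega>. \<omega> j)"
      using that by (subst distr_distr) (auto simp: L_def M_def Y_def comp_def intro!: distr_cong)
    also have "\<dots> = \<mu>"
      unfolding distr_snd unfolding L_def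
      using that \<mu>.prob_space_axioms by (intro distr_PiM_component) auto
    finally show ?thesis .
  qed
  have "indep_vars (\<lambda>_. borel) Y ?I"
  proof (subst indep_vars_iff_distr_eq_PiM')
    have "PiM ?I (\<lambda>i. distr M borel (Y i)) = L"
      unfolding L_def by (intro PiM_cong) (auto simp: dY)
    then show "distr M ?P ?Y = PiM ?I (\<lambda>i. distr M borel (Y i))"
      using dYs by simp
  qed (use mY in auto)
  moreover have "indep_set {N -` A \<inter> space M | A. A \<in> sets ?C} {?Y -` B \<inter> space M | B. B \<in> sets ?P}"
  proof (rule indep_setI)
    show "{N -` A \<inter> space M | A. A \<in> sets ?C} \<subseteq> events"
      "{?Y -` B \<inter> space M | B. B \<in> sets ?P} \<subseteq> events"
      using measurable_sets[OF mN] measurable_sets[OF mYs] by blast+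
    fix a b
    assume "a \<in> {N -` A \<inter> space M | A. A \<in> sets ?C}"
      and "b \<in> {?Y -` B \<inter> space M | B. B \<in> sets ?P}"
    then obtain A B where a: "a = N -` A \<inter> space M" and A: "A \<in> sets ?C"
      and b: "b = ?Y -` B \<inter> space M" and B: "B \<in> sets ?P"
      by (elim CollectE exE conjE)
    \<comment> \<open>Each preimage is a rectangle with one full side, and their intersection is the
      rectangle \<open>A \<times> B\<close>; independence is then the product formula for measures
      of rectangles.\<close>
    have eN: "N -` A \<inter> space M = A \<times> space L"
      by (auto simp: N_def M_def space_pair_measure K_def)
    have eY: "?Y -` B \<inter> space M = space K \<times> B"
      using sets.sets_into_space[OF B] restr
      by (auto simp: spaceM K_def)
    have eNY: "N -` A \<inter> space M \<inter> (?Y -` B \<inter> space M) = A \<times> B"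
      unfolding eN eY using sets.sets_into_space[OF B] sets_eq_imp_space_eq[OF setsL]
      by (auto simp: K_def)
    have AK: "A \<in> sets K" and BL: "B \<in> sets L"
      using A B by (auto simp: setsK setsL)
    have times: "prob (A' \<times> B') = measure K A' * measure L B'"
      if "A' \<in> sets K" "B' \<in> sets L" for A' B'
      using that unfolding M_def
      by (simp add: measure_def L.emeasure_pair_measure_Times enn2real_mult)
    show "prob (a \<inter> b) = prob a * prob b"
      unfolding a b eNY unfolding eN eY using AK BL
      by (simp add: times K.prob_space L.prob_space)
  qed
  moreover have "measure M {\<omega> \<in> space M. N \<omega> = k} = r * (1 - r) ^ (k - 1)" if "k \<ge> 1" for k
  proof -
    have "{\<omega> \<in> space M. N \<omega> = k} = {k} \<times> space L"
      by (auto simp: N_def M_def space_pair_measure K_def)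
    then have "measure M {\<omega> \<in> space M. N \<omega> = k} = measure K {k}"
      by (simp add: M_def measure_def L.emeasure_pair_measure_Times L.emeasure_space_1 setsK)
    also have "\<dots> = pmf (map_pmf Suc (geometric_pmf r)) (Suc (k - 1))"
      using that by (simp add: K_def measure_pmf_single)
    also have "\<dots> = r * (1 - r) ^ (k - 1)"
      using assms by (subst pmf_map_inj') auto
    finally show ?thesis .
  qed
  ultimately have "geometric_sum_representation (distr M borel (\<lambda>\<omega>. \<Sum>j=1..N \<omega>. Y j \<omega>)) r M N Y"
    unfolding geometric_sum_representation_def using prob_space_axioms mN dY by auto
  then show ?thesis
    using dY by blast
qed

text \<open>Compounding keeps characteristic functions within the class, because the result belongs
  to an actual random sum. This supplies the new laws needed in the final argument.\<close>

lemma geometric_compound_distribution_exists: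
  assumes "real_distribution \<mu>" "0 < r" "r < 1"
  shows "\<exists>\<nu>. real_distribution \<nu> \<and> (\<forall>t. char \<nu> t = geometric_compound r (char \<mu> t))"
proof -
  obtain D and M :: "(nat \<times> (nat \<Rightarrow> real)) measure" and N Y
    where D: "geometric_sum_representation D r M N Y" "distr M borel (Y 1) = \<mu>"
    using geometric_sum_representation_exists[OF assms] by blast
  show ?thesis
    using real_distribution_geometric_sum[OF D(1) assms(2,3)]
      char_geometric_sum[OF D(1) assms(2,3)] unfolding D(2) by blast
qed

section \<open>Geometric infinite divisibility through characteristic functions\<close>

text \<open>This removes sample spaces from the notion. For the converse, a geometric sum with
  summand law \<open>\<mu>\<close> is built first; its law has the characteristic function of
  \<open>D\<close> and hence is \<open>D\<close> by Levy's uniqueness theorem.\<close>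

lemma geometrically_inf_divisible_iff_char:
  assumes D: "real_distribution D"
  shows "geometrically_inf_divisible D \<longleftrightarrow>
    (\<forall>r\<in>{0<..<1}. \<exists>\<mu>. real_distribution \<mu> \<and> (\<forall>t. char D t = geometric_compound r (char \<mu> t)))"
    (is "_ \<longleftrightarrow> ?R")
proof
  assume gid: "geometrically_inf_divisible D"
  show ?R
  proof
    fix r :: real assume r: "r \<in> {0<..<1}"
    obtain M :: "(nat \<times> (nat \<Rightarrow> real)) measure" and N Y
      where M: "geometric_sum_representation D r M N Y"
      using bspec[OF gid[unfolded geometrically_inf_divisible_def] r] by (elim exE)
    show "\<exists>\<mu>. real_distribution \<mu> \<and> (\<forall>t. char D t = geometric_compound r (char \<mu> t))"
    proof (intro exI conjI allI)
      show "real_distribution (distr M borel (Y 1))"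
        using M r by (intro real_distribution_geometric_summand) auto
      show "char D t = geometric_compound r (char (distr M borel (Y 1)) t)" for t
        using M r by (intro char_geometric_sum) auto
    qed
  qed
next
  assume R: ?R
  show "geometrically_inf_divisible D"
  proof (rule geometrically_inf_divisibleI)
    fix r :: real assume r: "0 < r" "r < 1"
    then obtain \<mu> where \<mu>: "real_distribution \<mu>" "\<And>t. char D t = geometric_compound r (char \<mu> t)"
      using bspec[OF R, of r] by auto
    obtain E and M :: "(nat \<times> (nat \<Rightarrow> real)) measure" and N Y
      where E: "geometric_sum_representation E r M N Y" "distr M borel (Y 1) = \<mu>"
      using geometric_sum_representation_exists[OF \<mu>(1) r] by blast
    have "E = D"
      using real_distribution_geometric_sum[OF E(1) r] D
    proof (rule Levy_uniqueness)
      show "char E = char D"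
        using char_geometric_sum[OF E(1) r] by (simp add: fun_eq_iff E(2) \<mu>(2) del: One_nat_def)
    qed
    then show "\<exists>(M :: (nat \<times> (nat \<Rightarrow> real)) measure) N Y. geometric_sum_representation D r M N Y"
      using E(1) by blast
  qed
qed

section \<open>Distribution functions and the renewal equation\<close>

lemma
  assumes "proper_df_nonneg F"
  shows real_distribution_proper_df: "real_distribution (interval_measure F)"
    and cdf_proper_df: "cdf (interval_measure F) = F"
    and AE_nonneg_proper_df: "AE x in interval_measure F. 0 \<le> x"
proof -
  have mono: "\<And>x y. x \<le> y \<Longrightarrow> F x \<le> F y" and cont: "\<And>x. continuous (at_right x) F"
    and neg: "\<And>x. x < 0 \<Longrightarrow> F x = 0" and top: "(F \<longlongrightarrow> 1) at_top"
    using assms by (auto simp: proper_df_nonneg_def mono_def)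
  have bot: "(F \<longlongrightarrow> 0) at_bot"
    by (rule tendsto_eventually) (auto simp: eventually_at_bot_linorder neg intro!: exI[of _ "-1"])
  show "real_distribution (interval_measure F)"
    using mono cont bot top by (rule real_distribution_interval_measure)
  then interpret real_distribution "interval_measure F" .
  show cdf: "cdf (interval_measure F) = F"
    using mono cont bot by (rule cdf_interval_measure)
  \<comment> \<open>The half-lines ending at \<open>- 1 / real (Suc n)\<close> are null because
    \<open>F\<close> vanishes at their endpoints, and countably many of them cover the negative
    axis.\<close>
  have "AE x in interval_measure F. - 1 / real (Suc n) < x" for n
  proof (rule AE_I')
    show "{..- 1 / real (Suc n)} \<in> null_sets (interval_measure F)"
      using neg[of "- 1 / real (Suc n)"]
      by (intro null_setsI) (auto simp: emeasure_eq_measure cdf_def2[symmetric] cdf)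
  qed auto
  then have "AE x in interval_measure F. \<forall>n. - 1 / real (Suc n) < x"
    by (simp add: AE_all_countable)
  then show "AE x in interval_measure F. 0 \<le> x"
  proof eventually_elim
    case (elim x)
    show ?case
    proof (rule ccontr)
      assume "\<not> 0 \<le> x"
      then obtain n where "inverse (real (Suc n)) < - x"
        using reals_Archimedean[of "- x"] by auto
      then show False
        using elim[rule_format, of n] by (simp add: field_simps)
    qed
  qed
qed

text \<open>The renewal equation between distribution functions is an identity of laws. On
  characteristic functions convolution becomes a product, leaving a linear equation for that of
  \<open>Z\<close> whose coefficient is nonzero.\<close>

lemma char_renewal_solution:
  fixes G Z :: "real \<Rightarrow> real"
  assumes G: "proper_df_nonneg G" and p: "0 < p" "p < 1" and Z: "proper_df_nonneg Z"
    and renewal: "\<And>x. x \<ge> 0 \<Longrightarrow> Z x = p * G x + (1 - p) * df_convolution Z G x"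
  shows "char (interval_measure Z) t = geometric_compound p (char (interval_measure G) t)"
proof -
  let ?G = "interval_measure G" and ?Z = "interval_measure Z"
  let ?B = "measure_pmf (bernoulli_pmf p)"
  interpret G: real_distribution ?G by (rule real_distribution_proper_df[OF G])
  interpret Z: real_distribution ?Z by (rule real_distribution_proper_df[OF Z])
  interpret GZ: pair_prob_space ?G ?Z ..
  interpret B: prob_space ?B by (rule prob_space_measure_pmf)
  interpret BGZ: pair_prob_space ?B "?G \<Otimes>\<^sub>M ?Z" ..
  let ?P = "?B \<Otimes>\<^sub>M (?G \<Otimes>\<^sub>M ?Z)"
  \<comment> \<open>By the renewal equation \<open>Z\<close> is the law of \<open>V + (1 - B) W\<close> with \<open>V\<close>, \<open>W\<close>, \<open>B\<close> independent,
    \<open>V\<close> distributed as \<open>G\<close>, \<open>W\<close> as \<open>Z\<close>, and \<open>B\<close> Bernoulli with parameter \<open>p\<close>.\<close>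
  let ?X = "\<lambda>(b, v, w). if b then v else v + w :: real"
  have mX [measurable]: "?X \<in> borel_measurable ?P"
    by measurable
  \<comment> \<open>Stated for a general bounded \<open>f\<close> because it serves twice: with
    indicators of half-lines to identify the law of \<open>?X\<close>, and with \<open>iexp\<close>
    to compute its characteristic function.\<close>
  have expectation: "(\<integral>\<omega>. f (?X \<omega>) \<partial>?P) =
      complex_of_real p * (\<integral>v. f v \<partial>?G) + (1 - p) * (\<integral>v. (\<integral>w. f (v + w) \<partial>?Z) \<partial>?G)"
    if [measurable]: "f \<in> borel_measurable borel" and bd: "\<And>x. norm (f x) \<le> 1"
    for f :: "real \<Rightarrow> complex"
  proof -
    have int1: "integrable ?P (\<lambda>\<omega>. f (?X \<omega>))"
      by (rule BGZ.integrable_const_bound[where B = 1]) (auto simp: bd)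
    have int2: "integrable (?G \<Otimes>\<^sub>M ?Z) (\<lambda>(v, w). f (v + w))"
      by (rule GZ.integrable_const_bound[where B = 1]) (auto simp: bd)
    have int3: "integrable (?G \<Otimes>\<^sub>M ?Z) (\<lambda>(v, w). f v)"
      by (rule GZ.integrable_const_bound[where B = 1]) (auto simp: bd)
    have "(\<integral>\<omega>. f (?X \<omega>) \<partial>?P) = (\<integral>b. (\<integral>vw. f (?X (b, vw)) \<partial>(?G \<Otimes>\<^sub>M ?Z)) \<partial>?B)"
      by (rule BGZ.integral_fst'[OF int1, symmetric])
    also have "\<dots> = complex_of_real p * (\<integral>(v, w). f v \<partial>(?G \<Otimes>\<^sub>M ?Z)) +
        (1 - p) * (\<integral>(v, w). f (v + w) \<partial>(?G \<Otimes>\<^sub>M ?Z))"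
      using p by (subst integral_measure_pmf[of UNIV])
        (auto simp: UNIV_bool scaleR_conv_of_real case_prod_unfold)
    also have "(\<integral>(v, w). f v \<partial>(?G \<Otimes>\<^sub>M ?Z)) = (\<integral>v. f v \<partial>?G)"
      using GZ.integral_fst'[OF int3] Z.prob_space by simp
    also have "(\<integral>(v, w). f (v + w) \<partial>(?G \<Otimes>\<^sub>M ?Z)) = (\<integral>v. (\<integral>w. f (v + w) \<partial>?Z) \<partial>?G)"
      using GZ.integral_fst'[OF int2] by simp
    finally show ?thesis .
  qed
  define \<nu> where "\<nu> = distr ?P borel ?X"
  have \<nu>: "real_distribution \<nu>"
    unfolding \<nu>_def by (rule BGZ.real_distribution_distr) (rule mX)
  interpret \<nu>: real_distribution \<nu> by (rule \<nu>)
  \<comment> \<open>The integral over the whole line reduces to \<open>{0..x}\<close>: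
    \<open>G\<close> puts no mass on the negatives, and \<open>Z (x - v)\<close> is 0 for
    \<open>v > x\<close>.\<close>
  have conv: "(\<integral>v. Z (x - v) \<partial>?G) = df_convolution Z G x" for x
    unfolding df_convolution_def set_lebesgue_integral_def
  proof (rule integral_cong_AE)
    have [measurable]: "Z \<in> borel_measurable borel"
      using Z by (intro borel_measurable_mono) (simp add: proper_df_nonneg_def)
    show "(\<lambda>v. Z (x - v)) \<in> borel_measurable ?G"
      "(\<lambda>y. indicator {0..x} y *\<^sub>R Z (x - y)) \<in> borel_measurable ?G"
      by measurable
    show "AE v in ?G. Z (x - v) = indicator {0..x} v *\<^sub>R Z (x - v)"
      using AE_nonneg_proper_df[OF G]
    proof eventually_elim
      case (elim v)
      then show ?case
        using Z by (auto simp: proper_df_nonneg_def indicator_def)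
    qed
  qed
  have "cdf \<nu> x = Z x" for x
  proof -
    let ?f = "\<lambda>u. complex_of_real (indicator {..x} u)"
    have "complex_of_real (cdf \<nu> x) = (\<integral>u. ?f u \<partial>\<nu>)"
      by (simp add: cdf_def)
    also have "\<dots> = (\<integral>\<omega>. ?f (?X \<omega>) \<partial>?P)"
      unfolding \<nu>_def by (subst integral_distr) (rule mX, auto)
    also have "\<dots> = complex_of_real p * (\<integral>v. ?f v \<partial>?G) + (1 - p) * (\<integral>v. (\<integral>w. ?f (v + w) \<partial>?Z) \<partial>?G)"
      by (rule expectation) (auto simp: indicator_def)
    also have "(\<integral>v. ?f v \<partial>?G) = G x"
      using cdf_proper_df[OF G] by (simp add: cdf_def fun_eq_iff)
    also have "(\<lambda>v. \<integral>w. ?f (v + w) \<partial>?Z) = (\<lambda>v. complex_of_real (Z (x - v)))"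
    proof
      fix v
      have "(\<integral>w. ?f (v + w) \<partial>?Z) = (\<integral>w. complex_of_real (indicator {..x - v} w) \<partial>?Z)"
        by (intro Bochner_Integration.integral_cong) (auto simp: indicator_def)
      then show "(\<integral>w. ?f (v + w) \<partial>?Z) = Z (x - v)"
        using cdf_proper_df[OF Z] by (simp add: cdf_def fun_eq_iff)
    qed
    finally have "cdf \<nu> x = p * G x + (1 - p) * df_convolution Z G x"
      unfolding integral_complex_of_real conv
      by (metis of_real_1 of_real_add of_real_diff of_real_eq_iff of_real_mult)
    \<comment> \<open>The renewal equation is assumed only for \<open>x \<ge> 0\<close>; to the left
      of 0 all terms vanish, the convolution because \<open>{0..x}\<close> is empty.\<close>
    moreover have "df_convolution Z G x = 0" "G x = 0" "Z x = 0" if "x < 0"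
      using that G Z by (auto simp: df_convolution_def proper_df_nonneg_def set_lebesgue_integral_def)
    ultimately show ?thesis
      using renewal[of x] by (cases "x \<ge> 0") auto
  qed
  then have \<nu>Z: "\<nu> = ?Z"
    using cdf_proper_df[OF Z] by (intro cdf_unique \<nu> Z.real_distribution_axioms) auto
  let ?g = "char ?G t" and ?z = "char ?Z t"
  have "char \<nu> t = (\<integral>\<omega>. iexp (t * ?X \<omega>) \<partial>?P)"
    unfolding \<nu>_def char_def by (subst integral_distr) (rule mX, auto)
  also have "\<dots> = complex_of_real p * (\<integral>v. iexp (t * v) \<partial>?G) +
      (1 - p) * (\<integral>v. (\<integral>w. iexp (t * (v + w)) \<partial>?Z) \<partial>?G)"
    by (rule expectation) auto
  also have "(\<integral>v. (\<integral>w. iexp (t * (v + w)) \<partial>?Z) \<partial>?G) = (\<integral>v. iexp (t * v) * ?z \<partial>?G)"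
    by (simp add: char_def distrib_left exp_add)
  finally have "?z = p * ?g + (1 - p) * (?g * ?z)"
    unfolding \<nu>Z by (simp add: char_def)
  then have "?z * (1 - (1 - p) * ?g) = p * ?g"
    by (simp add: algebra_simps)
  then show ?thesis
    using geometric_compound_denominator_nonzero[OF p G.cmod_char_le_1]
    unfolding geometric_compound_def by (simp add: field_simps)
qed

section \<open>Transfer of divisibility between \<open>Z\<close> and \<open>G\<close>\<close>

theorem mainTheorem1:
  fixes G Z :: "real \<Rightarrow> real" and p q :: real
  assumes "proper_df_nonneg G"
    and "0 < p" and "p < 1" and "q = 1 - p"
    and "proper_df_nonneg Z"
    and "\<And>x. x \<ge> 0 \<Longrightarrow> Z x = p * G x + q * df_convolution Z G x"
  shows "geometrically_inf_divisible (interval_measure Z) \<longleftrightarrow>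
         geometrically_inf_divisible (interval_measure G)"
proof -
  let ?G = "interval_measure G" and ?Z = "interval_measure Z"
  have rG: "real_distribution ?G" and rZ: "real_distribution ?Z"
    using assms by (auto intro: real_distribution_proper_df)
  have ZG: "char ?Z t = geometric_compound p (char ?G t)" for t
    using assms by (intro char_renewal_solution) auto
  note le_1 = real_distribution.cmod_char_le_1
  show ?thesis
    unfolding geometrically_inf_divisible_iff_char[OF rG] geometrically_inf_divisible_iff_char[OF rZ]
  proof (intro iffI ballI)
    fix r :: real
    assume r: "r \<in> {0<..<1}"
      and R: "\<forall>r\<in>{0<..<1}. \<exists>\<mu>. real_distribution \<mu> \<and> (\<forall>t. char ?Z t = geometric_compound r (char \<mu> t))"
    have "p * r \<in> {0<..<1}"
      using r assms mult_strict_mono[of p 1 r 1] by auto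
    then obtain \<mu> where \<mu>: "real_distribution \<mu>" "\<And>t. char ?Z t = geometric_compound (p * r) (char \<mu> t)"
      using R by blast
    \<comment> \<open>Cancelling \<open>geometric_compound p\<close> requires both arguments to lie
      in the unit disc. Realising the compound of \<open>\<mu>\<close> as the characteristic
      function of a law \<open>\<nu>\<close> gives this bound.\<close>
    obtain \<nu> where \<nu>: "real_distribution \<nu>" "\<And>t. char \<nu> t = geometric_compound r (char \<mu> t)"
      using geometric_compound_distribution_exists[OF \<mu>(1)] r by auto
    have "char ?G t = char \<nu> t" for t
    proof (rule geometric_compound_inject)
      show "geometric_compound p (char ?G t) = geometric_compound p (char \<nu> t)"
        using r assms \<mu> by (simp add: \<nu>(2) geometric_compound_compose le_1 flip: ZG)
    qed (use assms le_1[OF rG] le_1[OF \<nu>(1)] in auto)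
    then show "\<exists>\<mu>. real_distribution \<mu> \<and> (\<forall>t. char ?G t = geometric_compound r (char \<mu> t))"
      using \<mu>(1) \<nu>(2) by auto
  next
    fix r :: real
    assume r: "r \<in> {0<..<1}"
      and R: "\<forall>r\<in>{0<..<1}. \<exists>\<mu>. real_distribution \<mu> \<and> (\<forall>t. char ?G t = geometric_compound r (char \<mu> t))"
    consider "r < p" | "r = p" | "p < r" by linarith
    then show "\<exists>\<mu>. real_distribution \<mu> \<and> (\<forall>t. char ?Z t = geometric_compound r (char \<mu> t))"
    proof cases
      case 1
      then have s: "r / p \<in> {0<..<1}"
        using r assms by auto
      then obtain \<mu> where \<mu>: "real_distribution \<mu>" "\<And>t. char ?G t = geometric_compound (r / p) (char \<mu> t)"
        using R by blast
      have "char ?Z t = geometric_compound r (char \<mu> t)" for t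
        using geometric_compound_compose[of p "r / p" "char \<mu> t"] s assms le_1[OF \<mu>(1)]
        by (simp add: ZG \<mu>(2))
      then show ?thesis
        using \<mu>(1) by blast
    next
      case 2
      then show ?thesis
        using rG ZG by blast
    next
      case 3
      then have s: "p / r \<in> {0<..<1}"
        using r assms by auto
      \<comment> \<open>The witness is \<open>G\<close> itself compounded with parameter
        \<open>p / r\<close>, chosen so that \<open>r * (p / r) = p\<close>.\<close>
      then obtain \<mu> where \<mu>: "real_distribution \<mu>" "\<And>t. char \<mu> t = geometric_compound (p / r) (char ?G t)"
        using geometric_compound_distribution_exists[OF rG, of "p / r"] by auto
      have "char ?Z t = geometric_compound r (char \<mu> t)" for t
        using geometric_compound_compose[of r "p / r" "char ?G t"] s r le_1[OF rG]
        by (simp add: ZG \<mu>(2))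
      then show ?thesis
        using \<mu>(1) by blast
    qed
  qed
qed

end
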